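(* Let $(X,\Sigma,\nu)$ be a measure space, let $\theta$ be a measure preserving transformation of $(X,\Sigma,\nu)$, and let $T$ be the operator induced by $\theta$ on $L^2(X,\Sigma,\nu)$, i.e. $Tf=f\circ\theta$. Let $b$ be any non-decreasing slowly varying function and let $f\in L^2(X,\Sigma,\nu)$ be such that $$\sum_{n\ge 1}\frac{b(n)\,\big\|\sum_{k=1}^nT^kf\big\|_{L^2(\nu)}^2}{n^2}<+\infty .$$ Then $$\frac{1}{\sqrt{n\,b^*(n)}}\sum_{k=1}^nT^kf\longrightarrow 0\qquad \nu\text{-a.s. as } n\to+\infty,$$ where $b^*(n):=\sum_{k=1}^n\frac{1}{k\,b(k)}$.
   Context: A function $b:(u_0,+\infty)\to(0,+\infty)$ is called slowly varying (in the sense of Zygmund) if for every $\delta>0$, $u^\delta b(u)$ is non-decreasing and $u^{-\delta}b(u)$ is non-increasing for $u$ large enough. Here $u_0<1$, so that $b(n)$ is defined and positive for every integer $n\ge1$. *)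

theory Defs
  imports "HOL-Analysis.Analysis"
begin

definition measure_preserving_transformation :: "'a measure \<Rightarrow> ('a \<Rightarrow> 'a) \<Rightarrow> bool" where
  "measure_preserving_transformation M \<theta> \<longleftrightarrow>
     \<theta> \<in> measurable M M \<and>
     (\<forall>A\<in>sets M. emeasure M (\<theta> -` A \<inter> space M) = emeasure M A)"

text \<open>Elements of \<open>L\<^sup>2\<close> are handled through complex-valued representatives; no
  identification modulo null sets is made. Real-valued functions are covered via the
  embedding of the reals in the complex numbers.\<close>

definition L2_functions :: "'a measure \<Rightarrow> ('a \<Rightarrow> complex) set" where
  "L2_functions M = {f \<in> borel_measurable M. integrable M (\<lambda>x. (cmod (f x))\<^sup>2)}"

text \<open>Only meaningful on \<open>L2_functions M\<close>: the Bochner integral of a non-integrable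
  function is 0.\<close>

definition L2_norm :: "'a measure \<Rightarrow> ('a \<Rightarrow> complex) \<Rightarrow> real" where
  "L2_norm M f = sqrt (\<integral>x. (cmod (f x))\<^sup>2 \<partial>M)"

definition induced_operator :: "('a \<Rightarrow> 'a) \<Rightarrow> ('a \<Rightarrow> complex) \<Rightarrow> ('a \<Rightarrow> complex)" where
  "induced_operator \<theta> f = f \<circ> \<theta>"

text \<open>\<open>b\<close> is a function from the open half-line \<open>{u0<..}\<close> to the positive reals; its values
  outside this half-line are irrelevant. The threshold \<open>U\<close> may depend on \<open>\<delta>\<close>.\<close>

definition slowly_varying :: "real \<Rightarrow> (real \<Rightarrow> real) \<Rightarrow> bool" where
  "slowly_varying u0 b \<longleftrightarrow>
     (\<forall>u>u0. 0 < b u) \<and>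
     (\<forall>\<delta>>0. \<exists>U>max 0 u0.
        mono_on {U<..} (\<lambda>u. u powr \<delta> * b u) \<and>
        antimono_on {U<..} (\<lambda>u. u powr (-\<delta>) * b u))"

definition b_star :: "(real \<Rightarrow> real) \<Rightarrow> nat \<Rightarrow> real" where
  "b_star b n = (\<Sum>k=1..n. 1 / (real k * b (real k)))"

definition ergodic_sum :: "('a \<Rightarrow> 'a) \<Rightarrow> ('a \<Rightarrow> complex) \<Rightarrow> nat \<Rightarrow> 'a \<Rightarrow> complex" where
  "ergodic_sum \<theta> f n = (\<lambda>x. \<Sum>k=1..n. (induced_operator \<theta> ^^ k) f x)"

end

theory Submission
  imports Defs
begin

text \<open>Fix a point \<open>x\<close>, put \<open>a i = f (\<theta>\<^bsup>i+1\<^esup> x)\<close> and let \<open>P n\<close> be the sum of the first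
  \<open>n\<close> terms of \<open>a\<close>, that is, the ergodic sum at \<open>x\<close>. Let \<open>P\<^sub>k y\<close> be the average of \<open>P\<close> over the
  \<open>2\<^sup>k\<close> points \<open>y, \<dots>, y + 2\<^sup>k - 1\<close>. Two identities hold: \<open>P\<^sub>k\<^sub>+\<^sub>1 y - P\<^sub>k y\<close> is half the
  average of the sums of \<open>a\<close> over the \<open>2\<^sup>k\<close> windows of length \<open>2\<^sup>k\<close> starting at
  these points, and \<open>P\<^sub>r n - P\<^sub>r 0\<close> is \<open>n/2\<^sup>r\<close> times such an average over \<open>n\<close> windows of
  length \<open>2\<^sup>r\<close>. Going from \<open>P\<close> to \<open>P\<^sub>r\<close> at both ends \<open>0\<close> and \<open>n\<close>, with
  \<open>2\<^sup>r \<le> n < 2\<^sup>r\<^sup>+\<^sup>1\<close>, therefore bounds \<open>P n\<close> by a sum over the scales \<open>k \<le> r\<close>. The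
  term of scale \<open>k\<close> is at most a constant times the square root of \<open>2\<^sup>-\<^sup>k \<Sum>\<^bsub>j<2n\<^esub> \<bar>V\<^bsub>2^k\<^esub> (\<theta>\<^sup>j x)\<bar>\<^sup>2\<close>, where
  \<open>V\<^sub>N\<close> is the ergodic sum of length \<open>N\<close> (\<open>norm_window_sum_le_scales\<close>). The usual dyadic chaining
  uses only windows that start at multiples of \<open>2\<^sup>k\<close>, and so leads to averages along the powers
  \<open>\<theta>\<close> to the \<open>2\<^sup>k\<close>, whose maximal functions cannot be summed over \<open>k\<close> by a weak type inequality.
  Averaging over all starting points keeps the one transformation \<open>\<theta>\<close>: the Cauchy-Schwarz
  inequality with the weights \<open>b (2\<^sup>k)\<close> gives
  \<open>\<bar>P n\<bar>\<^sup>2 \<le> C b\<^sup>*(n) \<Sum>\<^bsub>j<2n\<^esub> G (\<theta>\<^sup>j x)\<close> with \<open>G = \<Sum>\<^sub>k b (2\<^sup>k) 2\<^sup>-\<^sup>k \<bar>V\<^bsub>2^k\<^esub>\<bar>\<^sup>2\<close>,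
  because \<open>\<Sum>\<^sub>k\<^sub>\<le>\<^sub>r 1 / b (2\<^sup>k)\<close> is at most \<open>2 b\<^sup>*(n)\<close> (\<open>sum_dyadic_inverse_le\<close>).

  The function \<open>G\<close> is integrable: the hypothesis is a sum over all times, and the quasi-triangle
  inequality for the squared norms of ergodic sums turns it into a sum over dyadic times
  (\<open>dyadic_summable\<close>). The maximal inequality then shows that the averages of \<open>G\<close> along the orbit
  are bounded almost everywhere, which yields the bound \<open>O(sqrt (n b\<^sup>*(n)))\<close>. For the convergence to
  \<open>0\<close>, only the scales \<open>k \<ge> K\<close> are treated in this way: the tails of \<open>G\<close> have small integral, so
  their averages are uniformly small for suitable \<open>K\<close> (\<open>AE_small_ergodic_maximal\<close>). The scales below
  \<open>K\<close> contribute only the difference of \<open>P\<close> and \<open>P\<^sub>K\<close> at the two ends: a constant at \<open>0\<close>,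
  and at \<open>n\<close> a combination of \<open>2\<^sup>K\<close> terms of the sequence, which is \<open>o(sqrt n)\<close>
  because \<open>f\<close> is square integrable
  (\<open>AE_orbit_sqrt_negligible\<close>); and \<open>b\<^sup>*\<close> is bounded below by \<open>b\<^sup>*(1) > 0\<close>. These two contributions
  are put together, for a deterministic sequence, in \<open>window_sum_rate\<close>.\<close>

section \<open>Window sums and multiscale smoothing\<close>

text \<open>The type is a commutative monoid so that the same notion serves for the orbit of \<open>f\<close>
  in a normed space and for nonnegative extended reals in the maximal inequality.\<close>

definition window_sum :: "(nat \<Rightarrow> 'b::comm_monoid_add) \<Rightarrow> nat \<Rightarrow> nat \<Rightarrow> 'b" where
  "window_sum a N j = (\<Sum>i<N. a (j + i))"

lemma window_sum_0 [simp]: "window_sum a 0 j = 0"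
  by (simp add: window_sum_def)

lemma window_sum_add: "window_sum a (m + n) j = window_sum a m j + window_sum a n (j + m)"
  by (induction n) (simp_all add: window_sum_def add.assoc)

text \<open>The function \<open>P\<^sub>k\<close> of the opening comment. The lengths are powers of two so that each
  smoothing is the mean of two translates of the preceding one.\<close>

definition smoothed_primitive :: "(nat \<Rightarrow> 'b::real_normed_vector) \<Rightarrow> nat \<Rightarrow> nat \<Rightarrow> 'b" where
  "smoothed_primitive a k x = (\<Sum>i<2 ^ k. window_sum a (x + i) 0) /\<^sub>R 2 ^ k"

text \<open>An interval of length \<open>2 ^ (k+1)\<close> consists of two intervals of length \<open>2 ^ k\<close>, so that
  the new average is the mean of the old one at \<open>x\<close> and at \<open>x + 2 ^ k\<close>. The primitive varies between
  corresponding points of the two halves by sums over windows of length \<open>2 ^ k\<close>, one for every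
  starting point in the first half.\<close>

lemma smoothed_primitive_Suc:
  "smoothed_primitive a (Suc k) x - smoothed_primitive a k x
     = (1 / 2) *\<^sub>R ((\<Sum>i<2 ^ k. window_sum a (2 ^ k) (x + i)) /\<^sub>R 2 ^ k)"
proof -
  define P where "P = (\<lambda>y. window_sum a y 0)"
  have step: "P (x + 2 ^ k + i) = P (x + i) + window_sum a (2 ^ k) (x + i)" for i
    using window_sum_add[of a "x + i" "2 ^ k" 0] by (simp add: P_def add_ac)
  have "(\<Sum>i<2 ^ Suc k. P (x + i)) = window_sum P (2 ^ k + 2 ^ k) x"
    by (simp add: window_sum_def mult_2)
  also have "\<dots> = (\<Sum>i<2 ^ k. P (x + i)) + (\<Sum>i<2 ^ k. P (x + 2 ^ k + i))"
    unfolding window_sum_add by (simp add: window_sum_def)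
  also have "\<dots> = 2 *\<^sub>R (\<Sum>i<2 ^ k. P (x + i)) + (\<Sum>i<2 ^ k. window_sum a (2 ^ k) (x + i))"
    by (simp add: step sum.distrib scaleR_2)
  finally have "smoothed_primitive a (Suc k) x
      = (2 *\<^sub>R (\<Sum>i<2 ^ k. P (x + i)) + (\<Sum>i<2 ^ k. window_sum a (2 ^ k) (x + i))) /\<^sub>R 2 ^ Suc k"
    by (simp add: smoothed_primitive_def P_def)
  then show ?thesis
    by (simp add: smoothed_primitive_def P_def scaleR_add_right)
qed

text \<open>Both sides are the double sum of \<open>a (i + j)\<close> over \<open>i < 2 ^ r\<close> and \<open>j < n\<close>, divided by
  \<open>2 ^ r\<close>: the increment over \<open>n\<close> of a primitive smoothed at scale \<open>2 ^ r\<close> can be read as a sum of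
  windows of length \<open>2 ^ r\<close> even when \<open>n\<close> is not dyadic.\<close>

lemma smoothed_primitive_increment:
  "smoothed_primitive a r n - smoothed_primitive a r 0
     = (\<Sum>j<n. window_sum a (2 ^ r) j) /\<^sub>R 2 ^ r"
proof -
  have "window_sum a (n + i) 0 - window_sum a i 0 = window_sum a n i" for i
    using window_sum_add[of a i n 0] by (simp add: add.commute)
  then have "smoothed_primitive a r n - smoothed_primitive a r 0
      = (\<Sum>i<2 ^ r. window_sum a n i) /\<^sub>R 2 ^ r"
    by (simp add: smoothed_primitive_def flip: scaleR_diff_right sum_subtractf)
  also have "(\<Sum>i<2 ^ r. window_sum a n i) = (\<Sum>j<n. window_sum a (2 ^ r) j)"
    unfolding window_sum_def by (subst sum.swap) (simp add: add.commute)
  finally show ?thesis .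
qed

lemma norm_sum_le_sqrt_card:
  fixes v :: "'i \<Rightarrow> 'b::real_normed_vector"
  shows "norm (\<Sum>i\<in>A. v i) \<le> sqrt (card A * (\<Sum>i\<in>A. (norm (v i))\<^sup>2))"
proof -
  have "norm (\<Sum>i\<in>A. v i) \<le> (\<Sum>i\<in>A. 1 * norm (v i))"
    by (simp add: norm_sum)
  also have "\<dots> \<le> sqrt ((\<Sum>i\<in>A. 1\<^sup>2) * (\<Sum>i\<in>A. (norm (v i))\<^sup>2))"
    by (rule real_le_rsqrt, rule Cauchy_Schwarz_ineq_sum)
  finally show ?thesis by simp
qed

lemma norm_smoothing_step_le:
  fixes a :: "nat \<Rightarrow> 'b::real_normed_vector"
  assumes "x + 2 ^ k \<le> m"
  shows "norm (smoothed_primitive a (Suc k) x - smoothed_primitive a k x)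
           \<le> sqrt ((\<Sum>j<m. (norm (window_sum a (2 ^ k) j))\<^sup>2) / 2 ^ k) / 2"
proof -
  define v where "v = (\<lambda>j. (norm (window_sum a (2 ^ k) j))\<^sup>2)"
  have "(\<Sum>i<2 ^ k. v (x + i)) = sum v ((+) x ` {..<2 ^ k})"
    by (subst sum.reindex) (simp_all add: inj_on_def)
  also have "\<dots> \<le> sum v {..<m}"
    using assms by (intro sum_mono2) (auto simp: v_def)
  finally have sub: "(\<Sum>i<2 ^ k. v (x + i)) \<le> sum v {..<m}" .
  have "norm (\<Sum>i<2 ^ k. window_sum a (2 ^ k) (x + i)) \<le> sqrt (2 ^ k * (\<Sum>i<2 ^ k. v (x + i)))"
    using norm_sum_le_sqrt_card[of "\<lambda>i. window_sum a (2 ^ k) (x + i)" "{..<2 ^ k}"]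
    by (simp add: v_def)
  also have "\<dots> \<le> sqrt (2 ^ k * sum v {..<m})"
    using sub by simp
  also have "\<dots> = 2 ^ k * sqrt (sum v {..<m} / 2 ^ k)"
    by (simp add: real_sqrt_mult real_sqrt_divide field_simps)
  finally show ?thesis
    unfolding smoothed_primitive_Suc by (simp add: v_def divide_simps mult.commute)
qed

text \<open>The pathwise estimate behind the theorem. At both ends \<open>0\<close> and \<open>n\<close> the primitive is
  replaced by its smoothing at scale \<open>2 ^ K\<close>, then telescoped through the scales up to \<open>2 ^ r\<close>, where
  \<open>smoothed_primitive_increment\<close> finishes the chain. All windows that occur start before
  \<open>n + 2 ^ r \<le> 2 * n\<close>.\<close>

lemma norm_window_sum_le_scales:
  fixes a :: "nat \<Rightarrow> 'b::real_normed_vector"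
  assumes "K \<le> r" "2 ^ r \<le> n" "n < 2 ^ Suc r"
  shows "norm (window_sum a n 0)
           \<le> norm (smoothed_primitive a K n - window_sum a n 0) + norm (smoothed_primitive a K 0)
             + 2 * (\<Sum>k=K..r. sqrt ((\<Sum>j<2*n. (norm (window_sum a (2 ^ k) j))\<^sup>2) / 2 ^ k))"
proof -
  define P where "P = smoothed_primitive a"
  define q where "q = (\<lambda>k. sqrt ((\<Sum>j<2*n. (norm (window_sum a (2 ^ k) j))\<^sup>2) / 2 ^ k))"
  have q_nonneg: "q k \<ge> 0" for k
    by (simp add: q_def sum_nonneg)
  have tele: "norm (P r x - P K x) \<le> (\<Sum>k=K..<r. q k) / 2" if "x \<le> n" for x
  proof -
    have "P r x - P K x = (\<Sum>k=K..<r. P (Suc k) x - P k x)"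
      using \<open>K \<le> r\<close> sum_Suc_diff'[of K r "\<lambda>k. P k x"] by simp
    also have "norm \<dots> \<le> (\<Sum>k=K..<r. q k / 2)"
    proof (rule sum_norm_le)
      fix k assume "k \<in> {K..<r}"
      then have "(2::nat) ^ k \<le> 2 ^ r" by (intro power_increasing) auto
      then have "x + 2 ^ k \<le> 2 * n"
        using assms(2) that by linarith
      then show "norm (P (Suc k) x - P k x) \<le> q k / 2"
        unfolding P_def q_def by (rule norm_smoothing_step_le)
    qed
    finally show ?thesis by (simp add: sum_divide_distrib)
  qed
  \<comment> \<open>As \<open>n\<close> may be close to \<open>2 ^ (r+1)\<close>, the sum has up to twice as many terms as its divisor
    \<open>2 ^ r\<close>; this costs a factor \<open>sqrt 2\<close>, estimated by \<open>2\<close>.\<close>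
  have last: "norm (P r n - P r 0) \<le> 2 * q r"
  proof -
    have "norm (\<Sum>j<n. window_sum a (2 ^ r) j)
        \<le> sqrt (real n * (\<Sum>j<n. (norm (window_sum a (2 ^ r) j))\<^sup>2))"
      using norm_sum_le_sqrt_card[of "window_sum a (2 ^ r)" "{..<n}"] by simp
    also have "\<dots> \<le> sqrt ((2 ^ r * 2)\<^sup>2 * ((\<Sum>j<2*n. (norm (window_sum a (2 ^ r) j))\<^sup>2) / 2 ^ r))"
    proof -
      have "real n < real (2 ^ Suc r)"
        using assms(3) by (simp only: of_nat_less_iff)
      then have "real n \<le> (2 ^ r * 2)\<^sup>2 / 2 ^ r"
        by (simp add: power2_eq_square)
      moreover have "(\<Sum>j<n. (norm (window_sum a (2 ^ r) j))\<^sup>2)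
          \<le> (\<Sum>j<2*n. (norm (window_sum a (2 ^ r) j))\<^sup>2)"
        by (intro sum_mono2) auto
      ultimately have "real n * (\<Sum>j<n. (norm (window_sum a (2 ^ r) j))\<^sup>2)
          \<le> ((2 ^ r * 2)\<^sup>2 / 2 ^ r) * (\<Sum>j<2*n. (norm (window_sum a (2 ^ r) j))\<^sup>2)"
        by (intro mult_mono) (auto intro: sum_nonneg)
      then show ?thesis by simp
    qed
    also have "\<dots> = 2 ^ r * (2 * q r)"
      unfolding q_def real_sqrt_mult real_sqrt_abs by simp
    finally show ?thesis
      unfolding P_def smoothed_primitive_increment by (simp add: divide_simps mult.commute)
  qed
  have "window_sum a n 0 = (P r n - P r 0) + (P r 0 - P K 0) + (P K n - P r n)
      + (window_sum a n 0 - P K n) + P K 0"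
    by simp
  also have "norm \<dots> \<le> norm (P r n - P r 0) + norm (P r 0 - P K 0)
      + norm (P K n - P r n) + norm (window_sum a n 0 - P K n) + norm (P K 0)"
    by (intro norm_triangle_mono order_refl)
  finally have "norm (window_sum a n 0) \<le> norm (P r n - P r 0) + norm (P r 0 - P K 0)
      + norm (P r n - P K n) + norm (P K n - window_sum a n 0) + norm (P K 0)"
    by (simp add: norm_minus_commute)
  also have "\<dots> \<le> norm (P K n - window_sum a n 0) + norm (P K 0) + ((\<Sum>k=K..<r. q k) + 2 * q r)"
    using last tele[of 0] tele[of n] by simp
  also have "(\<Sum>k=K..<r. q k) + 2 * q r \<le> 2 * (\<Sum>k=K..r. q k)"
    using \<open>K \<le> r\<close> sum_nonneg[of "{K..<r}" q] q_nonneg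
    by (simp add: sum.last_plus)
  finally show ?thesis
    unfolding P_def q_def by simp
qed

text \<open>The Cauchy-Schwarz inequality that trades the sum over scales for a sum of squares; the
  weights \<open>w k = b (2 ^ k)\<close> will make the first factor comparable to \<open>b\<^sup>*\<close> and the second one integrable.\<close>

lemma weighted_sum_sqrt_le:
  fixes q w :: "'i \<Rightarrow> real"
  assumes "\<And>k. k \<in> A \<Longrightarrow> w k > 0" "\<And>k. k \<in> A \<Longrightarrow> q k \<ge> 0"
  shows "(\<Sum>k\<in>A. sqrt (q k)) \<le> sqrt ((\<Sum>k\<in>A. 1 / w k) * (\<Sum>k\<in>A. w k * q k))"
proof (rule real_le_rsqrt)
  have "(\<Sum>k\<in>A. sqrt (q k))\<^sup>2 = (\<Sum>k\<in>A. sqrt (1 / w k) * sqrt (w k * q k))\<^sup>2"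
    using assms by (intro arg_cong[where f="\<lambda>z. z\<^sup>2"] sum.cong)
      (auto simp: less_imp_neq[symmetric] simp flip: real_sqrt_mult)
  also have "\<dots> \<le> (\<Sum>k\<in>A. (sqrt (1 / w k))\<^sup>2) * (\<Sum>k\<in>A. (sqrt (w k * q k))\<^sup>2)"
    by (rule Cauchy_Schwarz_ineq_sum)
  also have "\<dots> = (\<Sum>k\<in>A. 1 / w k) * (\<Sum>k\<in>A. w k * q k)"
    using assms by (intro arg_cong2[where f="(*)"] sum.cong) (auto simp: less_imp_le)
  finally show "(\<Sum>k\<in>A. sqrt (q k))\<^sup>2 \<le> (\<Sum>k\<in>A. 1 / w k) * (\<Sum>k\<in>A. w k * q k)" .
qed

text \<open>What smoothing at a fixed scale costs at \<open>n\<close>: a bounded number of terms close to \<open>n\<close>.\<close>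

lemma smoothed_primitive_error:
  fixes a :: "nat \<Rightarrow> 'b::real_normed_vector"
  shows "norm (smoothed_primitive a K n - window_sum a n 0) \<le> (\<Sum>l<2 ^ K. norm (a (n + l)))"
proof -
  have "smoothed_primitive a K n - window_sum a n 0
      = (\<Sum>i<2 ^ K. window_sum a (n + i) 0 - window_sum a n 0) /\<^sub>R 2 ^ K"
    by (simp add: smoothed_primitive_def sum_subtractf scaleR_diff_right sum_constant_scaleR)
  also have "\<dots> = (\<Sum>i<2 ^ K. window_sum a i n) /\<^sub>R 2 ^ K"
    by (simp add: window_sum_add)
  also have "norm \<dots> \<le> (\<Sum>i<(2::nat) ^ K. \<Sum>l<2 ^ K. norm (a (n + l))) / 2 ^ K"
  proof -
    have "norm (\<Sum>i<2 ^ K. window_sum a i n) \<le> (\<Sum>i<(2::nat) ^ K. \<Sum>l<2 ^ K. norm (a (n + l)))"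
    proof (rule sum_norm_le)
      fix i :: nat assume "i \<in> {..<2 ^ K}"
      have "norm (window_sum a i n) \<le> (\<Sum>l<i. norm (a (n + l)))"
        unfolding window_sum_def by (rule norm_sum)
      also have "\<dots> \<le> (\<Sum>l<2 ^ K. norm (a (n + l)))"
        using \<open>i \<in> {..<2 ^ K}\<close> by (intro sum_mono2) auto
      finally show "norm (window_sum a i n) \<le> (\<Sum>l<2 ^ K. norm (a (n + l)))" .
    qed
    then show ?thesis by (simp add: divide_simps mult.commute)
  qed
  finally show ?thesis by simp
qed

section \<open>The maximal inequality\<close>

lemma distr_measure_preserving:
  assumes "measure_preserving_transformation M \<theta>"
  shows "distr M M \<theta> = M"
  using assms by (intro measure_eqI) (auto simp: measure_preserving_transformation_def emeasure_distr)

lemma measurable_iterate: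
  assumes "measure_preserving_transformation M \<theta>"
  shows "\<theta> ^^ j \<in> measurable M M"
proof (induction j)
  case (Suc j)
  have "\<theta> \<in> measurable M M"
    using assms by (simp add: measure_preserving_transformation_def)
  with Suc show ?case by (simp add: measurable_comp)
qed (simp add: id_def)

lemma distr_iterate:
  assumes "measure_preserving_transformation M \<theta>"
  shows "distr M M (\<theta> ^^ j) = M"
proof (induction j)
  case (Suc j)
  have "\<theta> \<in> measurable M M"
    using assms by (simp add: measure_preserving_transformation_def)
  then have "distr M M (\<theta> ^^ Suc j) = distr (distr M M (\<theta> ^^ j)) M \<theta>"
    by (simp add: distr_distr measurable_iterate[OF assms])
  then show ?case
    by (simp only: Suc distr_measure_preserving[OF assms])
qed (simp add: id_def distr_id)

lemma nn_integral_iterate: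
  assumes "measure_preserving_transformation M \<theta>" and "h \<in> borel_measurable M"
  shows "(\<integral>\<^sup>+x. h ((\<theta> ^^ j) x) \<partial>M) = (\<integral>\<^sup>+x. h x \<partial>M)"
proof -
  have "(\<integral>\<^sup>+x. h ((\<theta> ^^ j) x) \<partial>M) = (\<integral>\<^sup>+x. h x \<partial>distr M M (\<theta> ^^ j))"
    using assms(2) by (simp add: nn_integral_distr measurable_iterate[OF assms(1)])
  then show ?thesis
    by (simp add: distr_iterate[OF assms(1)])
qed

text \<open>Walk along the orbit from \<open>j\<close>. At a point outside \<open>E\<close> move on by one. At a point of \<open>E\<close>
  jump over the window of length at most \<open>N\<close> provided by the assumption; on it the sum of \<open>h\<close> pays
  \<open>t\<close> for each point, hence for each point of \<open>E\<close>. The last jump may overshoot the end by at most \<open>N\<close>.\<close>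

lemma covering_inequality:
  fixes h :: "nat \<Rightarrow> ennreal"
  assumes "\<And>j. j \<in> E \<Longrightarrow> \<exists>n\<in>{1..N}. t * of_nat n \<le> window_sum h n j"
  shows "(\<Sum>i<L. t * indicator E (j + i)) \<le> window_sum h (L + N) j"
proof (induction L arbitrary: j rule: less_induct)
  case (less L)
  define e where "e = (\<lambda>i. t * indicator E i :: ennreal)"
  have e_le: "window_sum e m i \<le> t * of_nat m" for m i
  proof -
    have "window_sum e m i \<le> (\<Sum>i<m. t)"
      unfolding window_sum_def e_def by (intro sum_mono) (auto simp: indicator_def)
    then show ?thesis by (simp add: mult.commute)
  qed
  have IH: "window_sum e m i \<le> window_sum h (m + N) i" if "m < L" for m i
    using less.IH[OF that, of i] by (simp add: window_sum_def e_def)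
  have "window_sum e L j \<le> window_sum h (L + N) j"
  proof (cases "j \<in> E")
    case False
    show ?thesis
    proof (cases L)
      case (Suc m)
      have "window_sum e (1 + m) j = window_sum e m (j + 1)"
        using False unfolding window_sum_add by (simp add: window_sum_def e_def)
      also have "\<dots> \<le> window_sum h (m + N) (j + 1)"
        using IH Suc by simp
      also have "\<dots> \<le> window_sum h (1 + (m + N)) j"
        unfolding window_sum_add by simp
      finally show ?thesis using Suc by simp
    qed simp
  next
    case True
    then obtain n where n: "1 \<le> n" "n \<le> N" "t * of_nat n \<le> window_sum h n j"
      using assms[OF True] by auto
    show ?thesis
    proof (cases "L \<le> n")
      case True
      have "window_sum e L j \<le> t * of_nat L" by (rule e_le)
      also have "\<dots> \<le> t * of_nat n"
        using True by (intro mult_left_mono) simp_all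
      also have "\<dots> \<le> window_sum h n j" by (rule n)
      also have "\<dots> \<le> window_sum h (n + (L + N - n)) j"
        unfolding window_sum_add by simp
      finally show ?thesis using n by simp
    next
      case False
      then obtain m where m: "L = n + m" "m < L"
        using n(1) by (metis add.commute le_add_diff_inverse2 less_add_same_cancel2 nat_le_linear not_one_le_zero zero_less_iff_neq_zero)
      have "window_sum e L j = window_sum e n j + window_sum e m (j + n)"
        unfolding m(1) by (rule window_sum_add)
      also have "\<dots> \<le> window_sum h n j + window_sum h (m + N) (j + n)"
        using e_le[of n j] n(3) IH[OF m(2)] by (intro add_mono) (auto intro: order_trans)
      also have "\<dots> = window_sum h (L + N) j"
        using m(1) by (simp add: add.assoc flip: window_sum_add)
      finally show ?thesis .
    qed
  qed
  then show ?case by (simp add: window_sum_def e_def)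
qed

text \<open>Divide by \<open>L\<close> and let \<open>L\<close> tend to infinity: the overshoot \<open>N\<close> of the covering argument disappears.\<close>

lemma ennreal_le_of_asymptotic_le:
  fixes c d :: ennreal
  assumes "\<And>L::nat. of_nat L * c \<le> of_nat (L + N) * d"
  shows "c \<le> d"
proof (cases "d = top")
  case False
  have *: "c \<le> d + of_nat N * d / of_nat (Suc L)" for L
  proof -
    have "of_nat (Suc L) * c \<le> of_nat (Suc L) * d + of_nat N * d"
      using assms[of "Suc L"] by (simp add: distrib_right add_ac)
    then have "of_nat (Suc L) * c / of_nat (Suc L) \<le> (of_nat (Suc L) * d + of_nat N * d) / of_nat (Suc L)"
      by (rule divide_right_mono_ennreal)
    moreover have "of_nat (Suc L) * z / of_nat (Suc L) = z" for z :: ennreal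
      by (subst mult.commute) (simp add: ennreal_mult_divide_eq del: of_nat_Suc)
    ultimately show ?thesis
      by (simp add: add_divide_distrib_ennreal del: of_nat_Suc)
  qed
  have "(\<lambda>L. d + of_nat N * d / of_nat (Suc L)) \<longlonglongrightarrow> d + 0"
  proof (intro tendsto_add tendsto_const)
    obtain D where D: "d = ennreal D" "D \<ge> 0" using False by (cases d) auto
    have "(\<lambda>L. ennreal (real N * D / real (Suc L))) \<longlonglongrightarrow> ennreal 0"
      by (intro tendsto_ennrealI LIMSEQ_Suc lim_const_over_n)
    moreover have "ennreal (real N * D / real (Suc L)) = of_nat N * d / of_nat (Suc L)" for L
      using D by (simp add: divide_ennreal[symmetric] ennreal_mult ennreal_of_nat_eq_real_of_nat del: of_nat_Suc)
    ultimately show "(\<lambda>L. of_nat N * d / of_nat (Suc L)) \<longlonglongrightarrow> 0" by simp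
  qed
  then show ?thesis
    using * by (intro LIMSEQ_le_const) auto
qed simp

text \<open>The weak type (1,1) inequality. The set \<open>E N\<close>, on which a window of length at most \<open>N\<close>
  already has a large average, is visited by the orbit at a set of times to which
  \<open>covering_inequality\<close> applies. Integrating the result and using the invariance of the measure
  compares \<open>L\<close> times \<open>t\<close> times the measure of \<open>E N\<close> with \<open>L + N\<close> times the integral. The argument is
  carried out with nonnegative integrals, and so holds for infinite measures as well.\<close>

lemma maximal_inequality:
  fixes h :: "'a \<Rightarrow> ennreal"
  assumes "measure_preserving_transformation M \<theta>" and [measurable]: "h \<in> borel_measurable M"
  shows "t * emeasure M {x\<in>space M. \<exists>n\<ge>1. t * of_nat n \<le> (\<Sum>j<n. h ((\<theta> ^^ j) x))}
           \<le> (\<integral>\<^sup>+x. h x \<partial>M)"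
proof -
  note [measurable] = measurable_iterate[OF assms(1)]
  define E where "E = (\<lambda>N. {x\<in>space M. \<exists>n\<in>{1..N}. t * of_nat n \<le> (\<Sum>j<n. h ((\<theta> ^^ j) x))})"
  have [measurable]: "E N \<in> sets M" for N
    unfolding E_def by measurable
  have trunc: "t * emeasure M (E N) \<le> (\<integral>\<^sup>+x. h x \<partial>M)" for N
  proof (rule ennreal_le_of_asymptotic_le)
    fix L :: nat
    have "of_nat L * (t * emeasure M (E N)) = (\<Sum>i<L. \<integral>\<^sup>+x. t * indicator (E N) x \<partial>M)"
      by (simp add: nn_integral_cmult)
    also have "\<dots> = (\<Sum>i<L. \<integral>\<^sup>+x. t * indicator (E N) ((\<theta> ^^ i) x) \<partial>M)"
      by (intro sum.cong refl nn_integral_iterate[OF assms(1), symmetric]) measurable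
    also have "\<dots> = (\<integral>\<^sup>+x. (\<Sum>i<L. t * indicator (E N) ((\<theta> ^^ i) x)) \<partial>M)"
      by (intro nn_integral_sum[symmetric]) measurable
    also have "\<dots> \<le> (\<integral>\<^sup>+x. (\<Sum>i<L + N. h ((\<theta> ^^ i) x)) \<partial>M)"
    proof (rule nn_integral_mono)
      fix x assume "x \<in> space M"
      have "(\<Sum>i<L. t * indicator {j. (\<theta> ^^ j) x \<in> E N} (0 + i))
          \<le> window_sum (\<lambda>j. h ((\<theta> ^^ j) x)) (L + N) 0"
      proof (rule covering_inequality)
        fix j assume "j \<in> {j. (\<theta> ^^ j) x \<in> E N}"
        then obtain n where "n \<in> {1..N}" "t * of_nat n \<le> (\<Sum>i<n. h ((\<theta> ^^ i) ((\<theta> ^^ j) x)))"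
          by (auto simp: E_def)
        moreover have "(\<theta> ^^ i) ((\<theta> ^^ j) x) = (\<theta> ^^ (j + i)) x" for i
          by (simp add: add.commute[of j] funpow_add)
        ultimately show "\<exists>n\<in>{1..N}. t * of_nat n \<le> window_sum (\<lambda>j. h ((\<theta> ^^ j) x)) n j"
          by (auto simp: window_sum_def)
      qed
      then show "(\<Sum>i<L. t * indicator (E N) ((\<theta> ^^ i) x)) \<le> (\<Sum>i<L + N. h ((\<theta> ^^ i) x))"
        by (simp add: window_sum_def indicator_def)
    qed
    also have "\<dots> = (\<Sum>i<L + N. \<integral>\<^sup>+x. h ((\<theta> ^^ i) x) \<partial>M)"
      by (intro nn_integral_sum) measurable
    also have "\<dots> = of_nat (L + N) * (\<integral>\<^sup>+x. h x \<partial>M)"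
      by (simp add: nn_integral_iterate[OF assms])
    finally show "of_nat L * (t * emeasure M (E N)) \<le> of_nat (L + N) * (\<integral>\<^sup>+x. h x \<partial>M)" .
  qed
  have "{x\<in>space M. \<exists>n\<ge>1. t * of_nat n \<le> (\<Sum>j<n. h ((\<theta> ^^ j) x))} = (\<Union>N. E N)"
    by (fastforce simp: E_def)
  moreover have "incseq E"
    unfolding E_def incseq_def by fastforce
  ultimately have "emeasure M {x\<in>space M. \<exists>n\<ge>1. t * of_nat n \<le> (\<Sum>j<n. h ((\<theta> ^^ j) x))}
      = (SUP N. emeasure M (E N))"
    by (subst SUP_emeasure_incseq) auto
  then show ?thesis
    using trunc by (simp add: SUP_mult_left_ennreal SUP_le_iff)
qed

text \<open>If the averages of \<open>h K\<close> exceeded a level for every \<open>K\<close>, the point would lie in a set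
  whose measure is at most a constant times the integral of \<open>h K\<close> for each \<open>K\<close>, hence in a null set;
  countably many levels suffice. The lemma serves twice, for the tails of the series \<open>G\<close> over scales
  and for the large values of the square of \<open>f\<close>.\<close>

lemma AE_small_ergodic_maximal:
  fixes h :: "nat \<Rightarrow> 'a \<Rightarrow> ennreal"
  assumes "measure_preserving_transformation M \<theta>"
    and meas [measurable]: "\<And>K. h K \<in> borel_measurable M"
    and lim: "(\<lambda>K. \<integral>\<^sup>+x. h K x \<partial>M) \<longlonglongrightarrow> 0"
  shows "AE x in M. \<forall>\<epsilon>>0. \<exists>K. \<forall>n\<ge>1. (\<Sum>j<n. h K ((\<theta> ^^ j) x)) < ennreal (\<epsilon> * real n)"
proof -
  note [measurable] = measurable_iterate[OF assms(1)]
  define B where "B = (\<lambda>(l::nat) K. {x\<in>space M. \<exists>n\<ge>1. ennreal (1 / Suc l) * of_nat n \<le> (\<Sum>j<n. h K ((\<theta> ^^ j) x))})"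
  have [measurable]: "B l K \<in> sets M" for l K
    unfolding B_def by measurable
  have "AE x in M. x \<notin> (\<Inter>K. B l K)" for l
  proof (rule AE_not_in)
    have "ennreal (1 / Suc l) * emeasure M (\<Inter>K. B l K) \<le> (\<integral>\<^sup>+x. h K x \<partial>M)" for K
    proof -
      have "ennreal (1 / Suc l) * emeasure M (\<Inter>K. B l K) \<le> ennreal (1 / Suc l) * emeasure M (B l K)"
        by (intro mult_left_mono emeasure_mono) auto
      also have "\<dots> \<le> (\<integral>\<^sup>+x. h K x \<partial>M)"
        unfolding B_def by (rule maximal_inequality[OF assms(1) meas])
      finally show ?thesis .
    qed
    then have "ennreal (1 / Suc l) * emeasure M (\<Inter>K. B l K) \<le> 0"
      by (intro LIMSEQ_le_const[OF lim]) auto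
    then have "emeasure M (\<Inter>K. B l K) = 0"
      by (auto simp: ennreal_eq_0_iff)
    then show "(\<Inter>K. B l K) \<in> null_sets M" by auto
  qed
  then have "AE x in M. \<forall>l. x \<notin> (\<Inter>K. B l K)"
    by (simp add: AE_all_countable)
  then show ?thesis
  proof (rule AE_mp, intro AE_I2 impI allI)
    fix x \<epsilon> assume x: "x \<in> space M" "\<forall>l. x \<notin> (\<Inter>K. B l K)" and "(\<epsilon>::real) > 0"
    obtain l where l: "1 / Suc l < \<epsilon>"
      using \<open>\<epsilon> > 0\<close> nat_approx_posE by blast
    obtain K where "x \<notin> B l K" using x by blast
    then have *: "(\<Sum>j<n. h K ((\<theta> ^^ j) x)) < ennreal (1 / Suc l) * of_nat n" if "n \<ge> 1" for n
    proof -
      have "\<not> (\<exists>n\<ge>1. ennreal (1 / Suc l) * of_nat n \<le> (\<Sum>j<n. h K ((\<theta> ^^ j) x)))"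
        using \<open>x \<notin> B l K\<close> x(1) unfolding B_def by blast
      then show ?thesis using that by (meson not_le)
    qed
    have **: "ennreal (1 / Suc l) * of_nat n \<le> ennreal (\<epsilon> * real n)" for n
    proof -
      have "ennreal (1 / Suc l) * of_nat n = ennreal (1 / Suc l * real n)"
        by (simp only: ennreal_mult ennreal_of_nat_eq_real_of_nat of_nat_0_le_iff zero_le_divide_1_iff)
      also have "\<dots> \<le> ennreal (\<epsilon> * real n)"
        using l by (intro ennreal_leI mult_right_mono) simp_all
      finally show ?thesis .
    qed
    show "\<exists>K. \<forall>n\<ge>1. (\<Sum>j<n. h K ((\<theta> ^^ j) x)) < ennreal (\<epsilon> * real n)"
      using * ** by (intro exI[of _ K] allI impI) (rule less_le_trans)
  qed
qed

section \<open>Ergodic sums of square integrable functions\<close>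

lemma funpow_induced_operator: "(induced_operator \<theta> ^^ k) f x = f ((\<theta> ^^ k) x)"
proof -
  have "induced_operator \<theta> g y = g (\<theta> y)" for g y
    by (simp add: induced_operator_def)
  then show ?thesis
    by (induction k arbitrary: f) (simp_all add: funpow_swap1)
qed

text \<open>The ergodic sums at the points of one orbit are the window sums of one sequence. The
  sequence starts with \<open>f (\<theta> x)\<close> because ergodic sums begin with \<open>T f\<close>.\<close>

lemma ergodic_sum_iterate:
  "ergodic_sum \<theta> f N ((\<theta> ^^ j) x) = window_sum (\<lambda>i. f ((\<theta> ^^ Suc i) x)) N j"
proof -
  have "(\<theta> ^^ Suc i) ((\<theta> ^^ j) x) = (\<theta> ^^ Suc (j + i)) x" for i
    by (simp add: add.commute[of j] funpow_add)
  moreover have "ergodic_sum \<theta> f N y = (\<Sum>i<N. f ((\<theta> ^^ Suc i) y))" for y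
    unfolding ergodic_sum_def funpow_induced_operator
    by (simp add: sum.atLeast1_atMost_eq)
  ultimately show ?thesis by (simp add: window_sum_def)
qed

lemma L2_norm_square: "(L2_norm M f)\<^sup>2 = (\<integral>x. (cmod (f x))\<^sup>2 \<partial>M)"
  by (simp add: L2_norm_def)

lemma cmod_add_square_le: "(cmod (u + v))\<^sup>2 \<le> 2 * (cmod u)\<^sup>2 + 2 * (cmod v)\<^sup>2"
proof -
  have "(cmod (u + v))\<^sup>2 \<le> (cmod u + cmod v)\<^sup>2"
    by (intro power_mono norm_triangle_ineq) simp
  also have "\<dots> \<le> 2 * (cmod u)\<^sup>2 + 2 * (cmod v)\<^sup>2"
    using sum_squares_bound[of "cmod u" "cmod v"] by (simp add: power2_sum)
  finally show ?thesis .
qed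

lemma L2_functions_add:
  assumes "f \<in> L2_functions M" "g \<in> L2_functions M"
  shows "(\<lambda>x. f x + g x) \<in> L2_functions M"
proof -
  have [measurable]: "f \<in> borel_measurable M" "g \<in> borel_measurable M"
    using assms by (auto simp: L2_functions_def)
  have "integrable M (\<lambda>x. (cmod (f x + g x))\<^sup>2)"
  proof (rule Bochner_Integration.integrable_bound)
    show "integrable M (\<lambda>x. 2 * (cmod (f x))\<^sup>2 + 2 * (cmod (g x))\<^sup>2)"
      using assms by (auto simp: L2_functions_def)
  qed (auto simp: cmod_add_square_le)
  then show ?thesis by (simp add: L2_functions_def)
qed

lemma L2_functions_iterate:
  assumes "measure_preserving_transformation M \<theta>" "f \<in> L2_functions M"
  shows "(\<lambda>x. f ((\<theta> ^^ j) x)) \<in> L2_functions M"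
    and "L2_norm M (\<lambda>x. f ((\<theta> ^^ j) x)) = L2_norm M f"
proof -
  note [measurable] = measurable_iterate[OF assms(1)]
  have [measurable]: "f \<in> borel_measurable M"
    using assms by (auto simp: L2_functions_def)
  have "integrable M (\<lambda>x. (cmod (f x))\<^sup>2)"
    using assms by (simp add: L2_functions_def)
  then have "integrable (distr M M (\<theta> ^^ j)) (\<lambda>x. (cmod (f x))\<^sup>2)"
    by (simp add: distr_iterate[OF assms(1)])
  then show "(\<lambda>x. f ((\<theta> ^^ j) x)) \<in> L2_functions M"
    by (simp add: integrable_distr_eq L2_functions_def)
  have "(\<integral>x. (cmod (f ((\<theta> ^^ j) x)))\<^sup>2 \<partial>M) = (\<integral>x. (cmod (f x))\<^sup>2 \<partial>distr M M (\<theta> ^^ j))"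
    by (rule integral_distr[symmetric]) measurable
  then show "L2_norm M (\<lambda>x. f ((\<theta> ^^ j) x)) = L2_norm M f"
    by (simp add: L2_norm_def distr_iterate[OF assms(1)])
qed

lemma ergodic_sum_add:
  "ergodic_sum \<theta> f (m + n) x = ergodic_sum \<theta> f m x + ergodic_sum \<theta> f n ((\<theta> ^^ m) x)"
  using ergodic_sum_iterate[of \<theta> f "m + n" 0 x] ergodic_sum_iterate[of \<theta> f m 0 x]
    ergodic_sum_iterate[of \<theta> f n m x]
  by (simp add: window_sum_add del: funpow.simps(2))

lemma ergodic_sum_L2:
  assumes "measure_preserving_transformation M \<theta>" "f \<in> L2_functions M"
  shows "ergodic_sum \<theta> f n \<in> L2_functions M"
proof (induction n)
  case 0
  then show ?case by (simp add: ergodic_sum_def L2_functions_def)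
next
  case (Suc n)
  have "ergodic_sum \<theta> f (Suc n) = (\<lambda>x. ergodic_sum \<theta> f n x + f ((\<theta> ^^ Suc n) x))"
    by (simp add: ergodic_sum_def funpow_induced_operator fun_eq_iff)
  then show ?case
    by (metis L2_functions_add[OF Suc L2_functions_iterate(1)[OF assms]])
qed

text \<open>The shifted sum \<open>V\<^sub>n \<circ> \<theta>\<^sup>m = V\<^bsub>m+n\<^esub> - V\<^sub>m\<close> has the same norm as \<open>V\<^sub>n\<close>.\<close>

lemma L2_norm_ergodic_sum_le:
  assumes "measure_preserving_transformation M \<theta>" "f \<in> L2_functions M"
  shows "(L2_norm M (ergodic_sum \<theta> f n))\<^sup>2
     \<le> 2 * (L2_norm M (ergodic_sum \<theta> f (m + n)))\<^sup>2 + 2 * (L2_norm M (ergodic_sum \<theta> f m))\<^sup>2"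
proof -
  let ?V = "ergodic_sum \<theta> f"
  note L2 = ergodic_sum_L2[OF assms]
  have int: "integrable M (\<lambda>x. (cmod (?V k x))\<^sup>2)" for k
    using L2[of k] by (simp add: L2_functions_def)
  have int': "integrable M (\<lambda>x. (cmod (?V n ((\<theta> ^^ m) x)))\<^sup>2)"
    using L2_functions_iterate(1)[OF assms(1) L2, where j=m] by (simp add: L2_functions_def)
  have "(L2_norm M (?V n))\<^sup>2 = (\<integral>x. (cmod (?V n ((\<theta> ^^ m) x)))\<^sup>2 \<partial>M)"
    using L2_functions_iterate(2)[OF assms(1) L2, where j=m]
    by (simp flip: L2_norm_square)
  also have "\<dots> \<le> (\<integral>x. 2 * (cmod (?V (m + n) x))\<^sup>2 + 2 * (cmod (?V m x))\<^sup>2 \<partial>M)"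
  proof (intro integral_mono int')
    show "integrable M (\<lambda>x. 2 * (cmod (?V (m + n) x))\<^sup>2 + 2 * (cmod (?V m x))\<^sup>2)"
      using int by auto
    show "(cmod (?V n ((\<theta> ^^ m) x)))\<^sup>2 \<le> 2 * (cmod (?V (m + n) x))\<^sup>2 + 2 * (cmod (?V m x))\<^sup>2" for x
      using cmod_add_square_le[of "?V (m + n) x" "- ?V m x"] by (simp add: ergodic_sum_add)
  qed
  also have "\<dots> = 2 * (L2_norm M (?V (m + n)))\<^sup>2 + 2 * (L2_norm M (?V m))\<^sup>2"
    using int by (simp add: L2_norm_square)
  finally show ?thesis .
qed

section \<open>Passing to dyadic times\<close>

text \<open>As \<open>I\<close> may oscillate, its values at dyadic times have to be compared with averages.
  Averaging the quasi-triangle inequality over \<open>m \<in> {N..<2 * N}\<close> bounds \<open>I N\<close> by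
  a multiple of the mean of \<open>I\<close> over \<open>{N..<3 * N}\<close>, and for \<open>N = 2 ^ k\<close> this interval is contained in two
  consecutive dyadic blocks, so that each time is counted at most twice.\<close>

lemma dyadic_summable:
  fixes \<beta> I :: "nat \<Rightarrow> real"
  assumes pos: "\<And>n. n \<ge> 1 \<Longrightarrow> \<beta> n > 0"
    and mono: "\<And>m n. 1 \<le> m \<Longrightarrow> m \<le> n \<Longrightarrow> \<beta> m \<le> \<beta> n"
    and I_nonneg: "\<And>n. I n \<ge> 0"
    and quasi: "\<And>m n. I n \<le> 2 * I (m + n) + 2 * I m"
    and summable: "(\<lambda>n. \<beta> n * I n / (real n)\<^sup>2) summable_on {1..}"
  shows "summable (\<lambda>k. \<beta> (2 ^ k) * I (2 ^ k) / 2 ^ k)"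
proof -
  define c where "c = (\<lambda>n. \<beta> n * I n / (real n)\<^sup>2)"
  have c_nonneg: "c n \<ge> 0" if "n \<ge> 1" for n
    using pos[OF that] I_nonneg by (simp add: c_def)
  define S where "S = (\<Sum>\<^sub>\<infinity>n\<in>{1..}. c n)"
  have S: "sum c A \<le> S" if "finite A" "A \<subseteq> {1..}" for A
    unfolding S_def using summable that c_nonneg
    by (intro finite_sum_le_infsum) (auto simp: c_def)
  have block: "\<beta> N * I N / N \<le> 18 * sum c {N..<3 * N}" if "N \<ge> 1" for N
  proof -
    have "real N * I N = (\<Sum>m\<in>{N..<2 * N}. I N)"
      by simp
    also have "\<dots> \<le> (\<Sum>m\<in>{N..<2 * N}. 2 * I (m + N) + 2 * I m)"
      by (intro sum_mono quasi)
    also have "\<dots> = 2 * (\<Sum>m\<in>{N + N..<2 * N + N}. I m) + 2 * (\<Sum>m\<in>{N..<2 * N}. I m)"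
      by (subst sum.shift_bounds_nat_ivl) (simp add: sum.distrib sum_distrib_left)
    also have "\<dots> = 2 * (\<Sum>m\<in>{N..<3 * N}. I m)"
    proof -
      have eqs: "N + N = 2 * N" "2 * N + N = 3 * N" by simp_all
      have "sum I {N..<2 * N} + sum I {2 * N..<3 * N} = sum I {N..<3 * N}"
        by (rule sum.atLeastLessThan_concat) simp_all
      then show ?thesis unfolding eqs by simp
    qed
    finally have "\<beta> N * (real N * I N) \<le> \<beta> N * (2 * (\<Sum>m\<in>{N..<3 * N}. I m))"
      using pos[OF that] by (intro mult_left_mono) auto
    also have "\<dots> = 2 * (\<Sum>m\<in>{N..<3 * N}. \<beta> N * I m)"
      by (simp add: sum_distrib_left mult.left_commute)
    \<comment> \<open>\<open>\<beta>\<close> is nondecreasing and \<open>m < 3 * N\<close>: the constant \<open>18\<close> is \<open>2 * 3\<^sup>2\<close>.\<close>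
    also have "\<dots> \<le> 2 * (\<Sum>m\<in>{N..<3 * N}. (3 * real N)\<^sup>2 * c m)"
    proof (intro mult_left_mono sum_mono)
      fix m assume m: "m \<in> {N..<3 * N}"
      then have "real m > 0" "real m \<le> 3 * real N" using that by auto
      then have "(real m)\<^sup>2 \<le> (3 * real N)\<^sup>2"
        by (intro power_mono) auto
      have "\<beta> N * I m \<le> \<beta> m * I m"
        using m that by (intro mult_right_mono mono I_nonneg) auto
      also have "\<dots> = (real m)\<^sup>2 * c m"
        using \<open>real m > 0\<close> by (simp add: c_def)
      also have "\<dots> \<le> (3 * real N)\<^sup>2 * c m"
        using m that \<open>(real m)\<^sup>2 \<le> (3 * real N)\<^sup>2\<close> by (intro mult_right_mono c_nonneg) auto
      finally show "\<beta> N * I m \<le> (3 * real N)\<^sup>2 * c m" .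
    qed simp
    also have "\<dots> = (real N)\<^sup>2 * (18 * sum c {N..<3 * N})"
      by (simp add: power_mult_distrib flip: sum_distrib_left)
    finally have "real N * (\<beta> N * I N) \<le> real N * (real N * (18 * sum c {N..<3 * N}))"
      by (simp add: power2_eq_square mult_ac)
    then show ?thesis
      using that by (simp add: divide_simps mult_ac)
  qed
  define D where "D = (\<lambda>k. sum c {2 ^ k..<2 ^ Suc k})"
  have D_sum: "sum D {m..<m + n} \<le> S" for m n
  proof -
    have "sum D {m..<m + n} = sum c {2 ^ m..<2 ^ (m + n)}"
    proof (induction n)
      case (Suc n)
      then show ?case
        using sum.atLeastLessThan_concat[of "2 ^ m" "2 ^ (m + n)" "2 ^ (m + Suc n)" c]
        by (simp add: D_def power_increasing)
    qed simp
    also have "\<dots> \<le> S"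
    proof (rule S)
      show "{2 ^ m..<2 ^ (m + n)} \<subseteq> {1::nat..}"
        using one_le_power[OF one_le_numeral] order_trans by (meson atLeastLessThan_iff atLeast_iff subsetI)
    qed simp
    finally show ?thesis .
  qed
  have u_le: "\<beta> (2 ^ k) * I (2 ^ k) / 2 ^ k \<le> 18 * (D k + D (k + 1))" for k
  proof -
    have "D k + D (k + 1) = sum c {2 ^ k..<4 * 2 ^ k}"
      using sum.atLeastLessThan_concat[of "2 ^ k" "2 * 2 ^ k" "4 * 2 ^ k" c]
      by (simp add: D_def mult.assoc[symmetric])
    also have "\<dots> \<ge> sum c {2 ^ k..<3 * 2 ^ k}"
    proof (intro sum_mono2)
      fix n :: nat assume "n \<in> {2 ^ k..<4 * 2 ^ k} - {2 ^ k..<3 * 2 ^ k}"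
      then have "1 \<le> n" using one_le_power[of "2::nat" k] by (auto dest: order_trans)
      then show "c n \<ge> 0" by (rule c_nonneg)
    qed auto
    finally show ?thesis
      using block[of "2 ^ k"] by simp
  qed
  show ?thesis
  proof (rule summableI_nonneg_bounded)
    show "0 \<le> \<beta> (2 ^ k) * I (2 ^ k) / 2 ^ k" for k
      using pos[of "2 ^ k"] I_nonneg by simp
    fix n
    have "(\<Sum>k<n. \<beta> (2 ^ k) * I (2 ^ k) / 2 ^ k) \<le> (\<Sum>k<n. 18 * (D k + D (k + 1)))"
      by (intro sum_mono u_le)
    also have "\<dots> = 18 * (sum D {0..<0 + n} + sum D {1..<1 + n})"
      using sum.shift_bounds_nat_ivl[of D 0 1 n]
      by (simp add: sum.distrib sum_distrib_left lessThan_atLeast0)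
    also have "\<dots> \<le> 18 * (S + S)"
      by (intro mult_left_mono add_mono D_sum) simp
    finally show "(\<Sum>k<n. \<beta> (2 ^ k) * I (2 ^ k) / 2 ^ k) \<le> 18 * (S + S)" .
  qed
qed

text \<open>Cauchy condensation: the block \<open>{2 ^ (k-1)<..2 ^ k}\<close> has \<open>2 ^ (k-1)\<close> terms, each at least
  \<open>1 / (2 ^ k * \<beta> (2 ^ k))\<close>; the first term takes care of \<open>k = 0\<close>. The right-hand side is twice \<open>b\<^sup>*(2\<^sup>r)\<close>.\<close>

lemma sum_dyadic_inverse_le:
  fixes \<beta> :: "nat \<Rightarrow> real"
  assumes pos: "\<And>n. n \<ge> 1 \<Longrightarrow> \<beta> n > 0"
    and mono: "\<And>m n. 1 \<le> m \<Longrightarrow> m \<le> n \<Longrightarrow> \<beta> m \<le> \<beta> n"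
  shows "(\<Sum>k\<le>r. 1 / \<beta> (2 ^ k)) \<le> 2 * (\<Sum>m=1..2 ^ r. 1 / (real m * \<beta> m))"
proof (induction r)
  case 0
  then show ?case using pos[of 1] by (simp add: divide_right_mono)
next
  case (Suc r)
  have "1 / \<beta> (2 ^ Suc r) = 2 * (\<Sum>m\<in>{2 ^ r<..2 ^ Suc r :: nat}. 1 / (2 ^ Suc r * \<beta> (2 ^ Suc r)))"
    by simp
  also have "\<dots> \<le> 2 * (\<Sum>m\<in>{2 ^ r<..2 ^ Suc r}. 1 / (real m * \<beta> m))"
  proof (intro mult_left_mono sum_mono)
    fix m :: nat assume m: "m \<in> {2 ^ r<..2 ^ Suc r}"
    then have "m \<ge> 1" by auto
    have "real m \<le> real (2 ^ Suc r)" using m by (simp only: of_nat_le_iff greaterThanAtMost_iff)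
    then have "real m * \<beta> m \<le> 2 ^ Suc r * \<beta> (2 ^ Suc r)"
      using m \<open>m \<ge> 1\<close> pos[OF \<open>m \<ge> 1\<close>] by (intro mult_mono mono) auto
    then show "1 / (2 ^ Suc r * \<beta> (2 ^ Suc r)) \<le> 1 / (real m * \<beta> m)"
      using \<open>m \<ge> 1\<close> pos[OF \<open>m \<ge> 1\<close>] pos[of "2 ^ Suc r"] by (intro divide_left_mono) auto
  qed simp
  finally have "1 / \<beta> (2 ^ Suc r) \<le> 2 * (\<Sum>m\<in>{2 ^ r<..2 ^ Suc r}. 1 / (real m * \<beta> m))" .
  moreover have "(\<Sum>m=1..2 ^ Suc r. 1 / (real m * \<beta> m))
      = (\<Sum>m=1..2 ^ r. 1 / (real m * \<beta> m)) + (\<Sum>m\<in>{2 ^ r<..2 ^ Suc r}. 1 / (real m * \<beta> m))"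
  proof -
    have "{1..2 ^ Suc r} = {1..2 ^ r} \<union> {2 ^ r<..2 ^ Suc r :: nat}"
      by (auto intro: order_trans)
    moreover have "{1..2 ^ r} \<inter> {2 ^ r<..2 ^ Suc r :: nat} = {}" by auto
    ultimately show ?thesis by (simp only: sum.union_disjoint finite_atLeastAtMost finite_greaterThanAtMost)
  qed
  ultimately show ?case using Suc by simp
qed

section \<open>The rate of growth\<close>

text \<open>The deterministic form of the theorem, for the values of \<open>f\<close> along a single orbit. The
  scales from \<open>K\<close> on are controlled by \<open>tails\<close>, uniformly in \<open>n\<close>, with a constant that is arbitrarily
  small for suitable \<open>K\<close>; the smoothing at the fixed scale \<open>2 ^ K\<close> is asymptotically negligible by
  \<open>small\<close>.\<close>

lemma window_sum_rate:
  fixes a :: "nat \<Rightarrow> 'b::real_normed_vector" and \<beta> :: "nat \<Rightarrow> real"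
  defines "B \<equiv> (\<lambda>n. \<Sum>m=1..n. 1 / (real m * \<beta> m))"
  assumes pos: "\<And>n. n \<ge> 1 \<Longrightarrow> \<beta> n > 0"
    and mono: "\<And>m n. 1 \<le> m \<Longrightarrow> m \<le> n \<Longrightarrow> \<beta> m \<le> \<beta> n"
    and small: "(\<lambda>n. norm (a n) / sqrt (Suc n)) \<longlonglongrightarrow> 0"
    and tails: "\<And>\<epsilon>. \<epsilon> > 0 \<Longrightarrow> \<exists>K. \<forall>n\<ge>1. \<forall>r.
        (\<Sum>j<n. \<Sum>k=K..r. \<beta> (2 ^ k) * (norm (window_sum a (2 ^ k) j))\<^sup>2 / 2 ^ k) \<le> \<epsilon> * real n"
  shows "(\<lambda>n. norm (window_sum a n 0) / sqrt (real n * B n)) \<longlonglongrightarrow> 0"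
proof (rule LIMSEQ_I)
  fix e :: real assume "e > 0"
  then have "(e / 8)\<^sup>2 > 0" by simp
  \<comment> \<open>With \<open>\<epsilon> = (e / 8)\<^sup>2\<close> the scales from \<open>K\<close> on contribute \<open>4 * sqrt \<epsilon> = e / 2\<close>.\<close>
  then obtain K where K: "\<And>n r. n \<ge> 1 \<Longrightarrow>
      (\<Sum>j<n. \<Sum>k=K..r. \<beta> (2 ^ k) * (norm (window_sum a (2 ^ k) j))\<^sup>2 / 2 ^ k) \<le> (e / 8)\<^sup>2 * real n"
    using tails by blast
  have B_mono: "B m \<le> B n" if "m \<le> n" for m n
    unfolding B_def using that pos by (intro sum_mono2) (auto simp: less_imp_le)
  have B1: "B 1 > 0" using pos[of 1] by (simp add: B_def)
  define err where "err = (\<lambda>n. (\<Sum>l<2 ^ K. norm (a (n + l))) + norm (smoothed_primitive a K 0))"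
  have "(\<lambda>n. err n / sqrt (real n)) \<longlonglongrightarrow> 0"
  proof -
    have a_shift: "(\<lambda>n. norm (a (n + l)) / sqrt (real n)) \<longlonglongrightarrow> 0" for l
    proof -
      have "(\<lambda>n. norm (a (n + l)) / sqrt (Suc (n + l)) * sqrt (1 + real (Suc l) / real n))
          \<longlonglongrightarrow> 0 * sqrt (1 + 0)"
        by (intro tendsto_intros LIMSEQ_ignore_initial_segment[OF small] lim_const_over_n)
      then have "(\<lambda>n. norm (a (n + l)) / sqrt (Suc (n + l)) * sqrt (1 + real (Suc l) / real n)) \<longlonglongrightarrow> 0"
        by simp
      then show ?thesis
      proof (rule Lim_transform_eventually)
        show "\<forall>\<^sub>F n in sequentially. norm (a (n + l)) / sqrt (Suc (n + l)) * sqrt (1 + real (Suc l) / real n)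
            = norm (a (n + l)) / sqrt (real n)"
          using eventually_gt_at_top[of 0]
        proof eventually_elim
          case (elim n)
          then have "1 + real (Suc l) / real n = real (Suc (n + l)) / real n"
            by (simp add: field_simps)
          then show ?case by (simp add: real_sqrt_divide del: of_nat_Suc)
        qed
      qed
    qed
    have "(\<lambda>n. (\<Sum>l<2 ^ K. norm (a (n + l)) / sqrt (real n))
        + norm (smoothed_primitive a K 0) / sqrt (real n)) \<longlonglongrightarrow> (\<Sum>l<(2::nat) ^ K. 0) + 0"
      by (intro tendsto_add tendsto_sum a_shift tendsto_divide_0[OF tendsto_const]
          filterlim_at_top_imp_at_infinity filterlim_compose[OF sqrt_at_top] filterlim_real_sequentially)
    then show ?thesis
      by (simp add: err_def add_divide_distrib sum_divide_distrib)
  qed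
  then have "(\<lambda>n. err n / sqrt (real n) / sqrt (B 1)) \<longlonglongrightarrow> 0"
    by (rule tendsto_divide_zero)
  then have "\<forall>\<^sub>F n in sequentially. err n / sqrt (real n) / sqrt (B 1) < e / 2"
    using \<open>e > 0\<close> by (intro order_tendstoD(2)[where y=0]) auto
  then have "\<forall>\<^sub>F n in sequentially. norm (norm (window_sum a n 0) / sqrt (real n * B n) - 0) < e"
    using eventually_ge_at_top[of "2 ^ K"]
  proof eventually_elim
    case (elim n)
    have "n \<ge> 1" using elim(2) one_le_power[of "2::nat" K] by linarith
    then obtain r where r: "2 ^ r \<le> n" "n < 2 ^ Suc r"
      using ex_power_ivl1[of 2 n] by auto
    have "K \<le> r"
    proof -
      have "(2::nat) ^ K < 2 ^ Suc r" using elim(2) r(2) by linarith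
      then show ?thesis by (simp add: less_Suc_eq_le del: power_Suc)
    qed
    have "B n \<ge> B 1" using \<open>n \<ge> 1\<close> by (rule B_mono)
    define q where "q = (\<lambda>k. (\<Sum>j<2*n. (norm (window_sum a (2 ^ k) j))\<^sup>2) / 2 ^ k)"
    have "(\<Sum>k=K..r. sqrt (q k)) \<le> sqrt ((\<Sum>k=K..r. 1 / \<beta> (2 ^ k)) * (\<Sum>k=K..r. \<beta> (2 ^ k) * q k))"
      by (intro weighted_sum_sqrt_le) (auto simp: q_def pos sum_nonneg)
    also have "\<dots> \<le> sqrt ((2 * B n) * ((e / 8)\<^sup>2 * real (2 * n)))"
    proof (intro real_sqrt_le_mono mult_mono)
      have "(\<Sum>k=K..r. 1 / \<beta> (2 ^ k)) \<le> (\<Sum>k\<le>r. 1 / \<beta> (2 ^ k))"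
        by (intro sum_mono2) (auto simp: pos less_imp_le)
      also have "\<dots> \<le> 2 * B (2 ^ r)"
        unfolding B_def using pos mono by (rule sum_dyadic_inverse_le)
      also have "\<dots> \<le> 2 * B n" using B_mono[OF r(1)] by simp
      finally show "(\<Sum>k=K..r. 1 / \<beta> (2 ^ k)) \<le> 2 * B n" .
      have "(\<Sum>k=K..r. \<beta> (2 ^ k) * q k)
          = (\<Sum>j<2*n. \<Sum>k=K..r. \<beta> (2 ^ k) * (norm (window_sum a (2 ^ k) j))\<^sup>2 / 2 ^ k)"
        by (subst sum.swap) (simp add: q_def sum_distrib_left sum_divide_distrib)
      also have "\<dots> \<le> (e / 8)\<^sup>2 * real (2 * n)"
        using \<open>n \<ge> 1\<close> by (intro K) simp
      finally show "(\<Sum>k=K..r. \<beta> (2 ^ k) * q k) \<le> (e / 8)\<^sup>2 * real (2 * n)" .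
      show "0 \<le> (\<Sum>k=K..r. \<beta> (2 ^ k) * q k)"
        by (intro sum_nonneg mult_nonneg_nonneg) (auto simp: q_def pos less_imp_le sum_nonneg)
      show "0 \<le> 2 * B n" using \<open>B n \<ge> B 1\<close> B1 by linarith
    qed
    also have "(2 * B n) * ((e / 8)\<^sup>2 * real (2 * n)) = (e / 4)\<^sup>2 * (real n * B n)"
      by (simp add: power2_eq_square)
    also have "sqrt \<dots> = e / 4 * sqrt (real n * B n)"
      using \<open>e > 0\<close> by (simp add: real_sqrt_mult)
    finally have main: "(\<Sum>k=K..r. sqrt (q k)) \<le> e / 4 * sqrt (real n * B n)" .
    have "norm (window_sum a n 0) \<le> norm (smoothed_primitive a K n - window_sum a n 0)
        + norm (smoothed_primitive a K 0) + 2 * (\<Sum>k=K..r. sqrt (q k))"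
      unfolding q_def by (rule norm_window_sum_le_scales[OF \<open>K \<le> r\<close> r])
    also have "\<dots> \<le> err n + e / 2 * sqrt (real n * B n)"
      using smoothed_primitive_error[of a K n] main by (simp add: err_def)
    finally have "norm (window_sum a n 0) \<le> err n + e / 2 * sqrt (real n * B n)" .
    moreover have "err n < e / 2 * sqrt (real n * B n)"
    proof -
      have "err n < e / 2 * (sqrt (real n) * sqrt (B 1))"
        using elim(1) B1 \<open>n \<ge> 1\<close> by (simp add: divide_simps mult_ac)
      also have "\<dots> \<le> e / 2 * sqrt (real n * B n)"
        using \<open>e > 0\<close> \<open>B n \<ge> B 1\<close> by (intro mult_left_mono) (auto simp: real_sqrt_mult intro!: mult_left_mono)
      finally show ?thesis .
    qed
    ultimately have "norm (window_sum a n 0) < e * sqrt (real n * B n)"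
      by linarith
    moreover have "real n * B n > 0"
      using \<open>n \<ge> 1\<close> \<open>B n \<ge> B 1\<close> B1 by simp
    ultimately show ?case by (simp add: divide_simps)
  qed
  then show "\<exists>no. \<forall>n\<ge>no. norm (norm (window_sum a n 0) / sqrt (real n * B n) - 0) < e"
    by (simp add: eventually_sequentially)
qed

text \<open>The truncations of \<open>\<bar>f\<bar>\<^sup>2\<close> to its values above \<open>K\<close> have small integral, so that, for
  suitable \<open>K\<close>, the ergodic sums of length \<open>n + 1\<close> of the truncation are at most \<open>\<epsilon> (n + 1)\<close>. Since
  these sums contain the term at time \<open>n\<close>, the value of \<open>\<bar>f\<bar>\<^sup>2\<close> there is at most
  \<open>K + \<epsilon> (n + 1)\<close>.\<close>

lemma AE_orbit_sqrt_negligible: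
  assumes "measure_preserving_transformation M \<theta>" "f \<in> L2_functions M"
  shows "AE x in M. (\<lambda>n. cmod (f ((\<theta> ^^ n) x)) / sqrt (real n)) \<longlonglongrightarrow> 0"
proof -
  have [measurable]: "f \<in> borel_measurable M"
    using assms by (auto simp: L2_functions_def)
  have int: "integrable M (\<lambda>x. (cmod (f x))\<^sup>2)"
    using assms by (simp add: L2_functions_def)
  define h where "h = (\<lambda>(K::nat) x. if (cmod (f x))\<^sup>2 > real K then ennreal ((cmod (f x))\<^sup>2) else 0)"
  have [measurable]: "h K \<in> borel_measurable M" for K
    unfolding h_def by measurable
  have "(\<lambda>K. \<integral>\<^sup>+x. h K x \<partial>M) \<longlonglongrightarrow> (\<integral>\<^sup>+x. 0 \<partial>M)"
  proof (rule nn_integral_dominated_convergence)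
    show "AE x in M. h K x \<le> ennreal ((cmod (f x))\<^sup>2)" for K
      by (simp add: h_def)
    show "(\<integral>\<^sup>+x. ennreal ((cmod (f x))\<^sup>2) \<partial>M) < \<infinity>"
      using int by (simp add: nn_integral_eq_integral)
    show "AE x in M. (\<lambda>K. h K x) \<longlonglongrightarrow> 0"
    proof (rule AE_I2)
      fix x
      have "\<forall>\<^sub>F K in sequentially. real K \<ge> (cmod (f x))\<^sup>2"
        using filterlim_real_sequentially by (simp add: filterlim_at_top)
      then have "\<forall>\<^sub>F K in sequentially. h K x = 0"
        by eventually_elim (simp add: h_def)
      then show "(\<lambda>K. h K x) \<longlonglongrightarrow> 0" by (rule tendsto_eventually)
    qed
  qed measurable
  then have "(\<lambda>K. \<integral>\<^sup>+x. h K x \<partial>M) \<longlonglongrightarrow> 0" by simp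
  from AE_small_ergodic_maximal[OF assms(1) _ this]
  have "AE x in M. \<forall>\<epsilon>>0. \<exists>K. \<forall>n\<ge>1. (\<Sum>j<n. h K ((\<theta> ^^ j) x)) < ennreal (\<epsilon> * real n)"
    by simp
  then show ?thesis
  proof eventually_elim
    case (elim x)
    define y where "y = (\<lambda>n. (cmod (f ((\<theta> ^^ n) x)))\<^sup>2)"
    have "(\<lambda>n. y n / real n) \<longlonglongrightarrow> 0"
    proof (rule LIMSEQ_I)
      fix e :: real assume "e > 0"
      then have "e / 4 > 0" by simp
      with elim obtain K where K: "\<And>n. n \<ge> 1 \<Longrightarrow> (\<Sum>j<n. h K ((\<theta> ^^ j) x)) < ennreal (e / 4 * real n)"
        by blast
      have y_le: "y n \<le> real K + e / 4 * real (Suc n)" for n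
      proof (cases "y n \<le> real K")
        case False
        then have "ennreal (y n) = h K ((\<theta> ^^ n) x)"
          by (simp add: h_def y_def)
        also have "\<dots> \<le> (\<Sum>j<Suc n. h K ((\<theta> ^^ j) x))"
          by simp
        also have "\<dots> \<le> ennreal (e / 4 * real (Suc n))"
          using K[of "Suc n"] by (simp add: less_imp_le)
        finally have "y n \<le> e / 4 * real (Suc n)"
          using \<open>e > 0\<close> by (subst (asm) ennreal_le_iff) auto
        then show ?thesis by simp
      next
        case True
        then show ?thesis using \<open>e > 0\<close> by (simp add: add_increasing2)
      qed
      have "norm (y n / real n - 0) < e" if n: "n \<ge> Suc (nat \<lceil>2 * real K / e\<rceil>)" for n
      proof -
        have "n \<ge> 1" "real n > 2 * real K / e" using n by linarith+
        then have "real K < e / 2 * real n" using \<open>e > 0\<close> by (simp add: field_simps)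
        moreover have "e / 4 * real (Suc n) \<le> e / 4 * (2 * real n)"
          using \<open>e > 0\<close> \<open>n \<ge> 1\<close> by (intro mult_left_mono) auto
        ultimately have "y n < e * real n"
          using y_le[of n] by simp
        then show ?thesis
          using \<open>n \<ge> 1\<close> by (simp add: y_def divide_simps)
      qed
      then show "\<exists>no. \<forall>n\<ge>no. norm (y n / real n - 0) < e" by blast
    qed
    then have "(\<lambda>n. sqrt (y n / real n)) \<longlonglongrightarrow> sqrt 0"
      by (rule tendsto_real_sqrt)
    then show ?case by (simp add: y_def real_sqrt_divide)
  qed
qed

theorem theorem4p2:
  fixes M :: "'a measure" and \<theta> :: "'a \<Rightarrow> 'a" and f :: "'a \<Rightarrow> complex"
    and u0 :: real and b :: "real \<Rightarrow> real"
  assumes "measure_preserving_transformation M \<theta>"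
    and "u0 < 1"
    and "slowly_varying u0 b"
    and "mono_on {u0<..} b"
    and "f \<in> L2_functions M"
    and "(\<lambda>n::nat. b (real n) * (L2_norm M (ergodic_sum \<theta> f n))\<^sup>2 / (real n)\<^sup>2)
           summable_on {1..}"
  shows "AE x in M. (\<lambda>n. complex_of_real (1 / sqrt (real n * b_star b n)) * ergodic_sum \<theta> f n x)
           \<longlonglongrightarrow> 0"
proof -
  define \<beta> where "\<beta> = (\<lambda>n. b (real n))"
  have pos: "\<beta> n > 0" if "n \<ge> 1" for n
    using assms(2,3) that by (simp add: \<beta>_def slowly_varying_def)
  have mono: "\<beta> m \<le> \<beta> n" if "1 \<le> m" "m \<le> n" for m n
    unfolding \<beta>_def using assms(2) that by (intro mono_onD[OF assms(4)]) auto
  have L2: "ergodic_sum \<theta> f n \<in> L2_functions M" for n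
    by (rule ergodic_sum_L2[OF assms(1,5)])
  have [measurable]: "ergodic_sum \<theta> f n \<in> borel_measurable M" for n
    using L2 by (simp add: L2_functions_def)
  define g where "g = (\<lambda>k x. \<beta> (2 ^ k) * (cmod (ergodic_sum \<theta> f (2 ^ k) x))\<^sup>2 / 2 ^ k)"
  define u where "u = (\<lambda>k. \<beta> (2 ^ k) * (L2_norm M (ergodic_sum \<theta> f (2 ^ k)))\<^sup>2 / 2 ^ k)"
  have g_nonneg: "g k x \<ge> 0" for k x
    using pos[of "2 ^ k"] by (simp add: g_def)
  have u_nonneg: "u k \<ge> 0" for k
    using pos[of "2 ^ k"] by (simp add: u_def)
  have u: "summable u"
    unfolding u_def using pos mono _ L2_norm_ergodic_sum_le[OF assms(1,5)]
    by (rule dyadic_summable) (use assms(6) in \<open>simp_all add: \<beta>_def\<close>)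
  have g_int: "(\<integral>\<^sup>+x. ennreal (g k x) \<partial>M) = ennreal (u k)" for k
  proof -
    have int: "integrable M (g k)"
      using L2[of "2 ^ k"] by (simp add: g_def L2_functions_def)
    have "(\<integral>x. g k x \<partial>M) = u k"
      by (simp add: u_def g_def L2_norm_square)
    then show ?thesis
      using int g_nonneg by (simp add: nn_integral_eq_integral)
  qed
  \<comment> \<open>The tails of the integrable function \<open>G\<close>; their integrals are the tails of the series \<open>u\<close>.\<close>
  define h where "h = (\<lambda>K x. \<Sum>i. ennreal (g (i + K) x))"
  have [measurable]: "h K \<in> borel_measurable M" for K
    unfolding h_def g_def by measurable
  have "(\<integral>\<^sup>+x. h K x \<partial>M) = ennreal (\<Sum>i. u (i + K))" for K
  proof -
    have [measurable]: "g k \<in> borel_measurable M" for k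
      unfolding g_def by measurable
    have "(\<integral>\<^sup>+x. h K x \<partial>M) = (\<Sum>i. \<integral>\<^sup>+x. ennreal (g (i + K) x) \<partial>M)"
      unfolding h_def by (intro nn_integral_suminf) measurable
    also have "\<dots> = ennreal (\<Sum>i. u (i + K))"
      using u u_nonneg by (simp add: g_int suminf_ennreal2 summable_ignore_initial_segment)
    finally show ?thesis .
  qed
  moreover have "(\<lambda>K. ennreal (\<Sum>i. u (i + K))) \<longlonglongrightarrow> ennreal 0"
    by (intro tendsto_ennrealI suminf_exist_split2 u)
  ultimately have "(\<lambda>K. \<integral>\<^sup>+x. h K x \<partial>M) \<longlonglongrightarrow> 0"
    by simp
  then have "AE x in M. \<forall>\<epsilon>>0. \<exists>K. \<forall>n\<ge>1. (\<Sum>j<n. h K ((\<theta> ^^ j) x)) < ennreal (\<epsilon> * real n)"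
    by (intro AE_small_ergodic_maximal[OF assms(1)]) auto
  then show ?thesis
    using AE_orbit_sqrt_negligible[OF assms(1,5)]
  proof eventually_elim
    case (elim x)
    define a where "a = (\<lambda>i. f ((\<theta> ^^ Suc i) x))"
    have sums: "ergodic_sum \<theta> f N ((\<theta> ^^ j) x) = window_sum a N j" for N j
      unfolding a_def by (rule ergodic_sum_iterate)
    have "(\<lambda>n. norm (window_sum a n 0) / sqrt (real n * (\<Sum>m=1..n. 1 / (real m * \<beta> m)))) \<longlonglongrightarrow> 0"
    proof (rule window_sum_rate)
      show "(\<lambda>n. norm (a n) / sqrt (real (Suc n))) \<longlonglongrightarrow> 0"
        unfolding a_def using elim(2) by (rule LIMSEQ_Suc)
      fix \<epsilon> :: real assume "\<epsilon> > 0"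
      with elim(1) obtain K where
        K: "\<And>n. n \<ge> 1 \<Longrightarrow> (\<Sum>j<n. h K ((\<theta> ^^ j) x)) < ennreal (\<epsilon> * real n)"
        by blast
      have "(\<Sum>j<n. \<Sum>k=K..r. g k ((\<theta> ^^ j) x)) \<le> \<epsilon> * real n" if "n \<ge> 1" for n r
      proof -
        have part: "ennreal (\<Sum>k=K..r. g k y) \<le> h K y" for y
        proof (cases "K \<le> r")
          case True
          have "(\<Sum>k=K..r. g k y) = (\<Sum>i<Suc r - K. g (i + K) y)"
            using True sum.shift_bounds_nat_ivl[of "\<lambda>k. g k y" 0 K "Suc r - K"]
            by (simp add: lessThan_atLeast0 atLeastLessThanSuc_atLeastAtMost)
          then have "ennreal (\<Sum>k=K..r. g k y) = (\<Sum>i<Suc r - K. ennreal (g (i + K) y))"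
            using g_nonneg by (simp add: sum_ennreal)
          also have "\<dots> \<le> h K y"
            unfolding h_def by (intro sum_le_suminf) auto
          finally show ?thesis .
        qed simp
        have "ennreal (\<Sum>j<n. \<Sum>k=K..r. g k ((\<theta> ^^ j) x))
            = (\<Sum>j<n. ennreal (\<Sum>k=K..r. g k ((\<theta> ^^ j) x)))"
          using g_nonneg by (simp add: sum_ennreal sum_nonneg)
        also have "\<dots> \<le> (\<Sum>j<n. h K ((\<theta> ^^ j) x))"
          by (intro sum_mono part)
        also have "\<dots> \<le> ennreal (\<epsilon> * real n)"
          using K[OF that] by simp
        finally show ?thesis
          using \<open>\<epsilon> > 0\<close> by (subst (asm) ennreal_le_iff) auto
      qed
      then show "\<exists>K. \<forall>n\<ge>1. \<forall>r. (\<Sum>j<n. \<Sum>k=K..r.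
          \<beta> (2 ^ k) * (norm (window_sum a (2 ^ k) j))\<^sup>2 / 2 ^ k) \<le> \<epsilon> * real n"
        unfolding g_def sums by blast
    qed (use pos mono in auto)
    then have "(\<lambda>n. norm (complex_of_real (1 / sqrt (real n * b_star b n)) * ergodic_sum \<theta> f n x)) \<longlonglongrightarrow> 0"
    proof (rule Lim_transform_eventually)
      show "\<forall>\<^sub>F n in sequentially. norm (window_sum a n 0) / sqrt (real n * (\<Sum>m=1..n. 1 / (real m * \<beta> m)))
        = norm (complex_of_real (1 / sqrt (real n * b_star b n)) * ergodic_sum \<theta> f n x)"
      proof (rule always_eventually, rule allI)
        fix n
        have "b_star b n \<ge> 0"
          unfolding b_star_def using pos by (intro sum_nonneg) (auto simp: \<beta>_def less_imp_le)
        then show "norm (window_sum a n 0) / sqrt (real n * (\<Sum>m=1..n. 1 / (real m * \<beta> m)))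
          = norm (complex_of_real (1 / sqrt (real n * b_star b n)) * ergodic_sum \<theta> f n x)"
          using sums[of n 0] by (simp add: b_star_def \<beta>_def norm_mult norm_divide)
      qed
    qed
    then show ?case by (rule tendsto_norm_zero_cancel)
  qed
qed

end
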